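(* Let $X$ be a Banach space and $M \subset X$ a closed subspace. If $m \in M$ is a very smooth point of $X$, then $m$ is a very smooth point of $M$. If, moreover, $M$ is an $M$-ideal in $X$, then every very smooth point of $M$ is also a very smooth point of $X$.
   Context: A unit vector $x$ of a Banach space $X$ is a smooth point of $X$ if there is exactly one $x^* \in X^*$ with $\|x^*\| = 1 = x^*(x)$. A unit vector $x \in X$ is a very smooth point of $X$ if, regarded as an element of $X^{**}$ under the canonical embedding $X \subset X^{**}$, it is a smooth point of $X^{**}$. A closed subspace $M \subset X$ is an $M$-ideal in $X$ if there is a linear projection $P : X^* \to X^*$ with $\|P(x^* )\| + \|x^* - P(x^* )\| = \|x^*\|$ for all $x^* \in X^*$ and $\ker P = M^\perp$. *)

theory Defs
  imports "HOL-Analysis.Analysis" "HOL-Library.Function_Algebras"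
begin

text \<open>The scalar field is \<open>\<real>\<close> or \<open>\<complex>\<close>, given by an isometric embedding into \<open>\<complex>\<close> whose range is
  one of the two.\<close>

class real_or_complex = real_normed_field +
  assumes real_or_complex:
    "\<exists>\<phi> :: 'a \<Rightarrow> complex. (\<forall>a b. \<phi> (a + b) = \<phi> a + \<phi> b) \<and> (\<forall>r a. \<phi> (r *\<^sub>R a) = r *\<^sub>R \<phi> a) \<and>
       (\<forall>a b. \<phi> (a * b) = \<phi> a * \<phi> b) \<and>
       (\<forall>a. norm (\<phi> a) = norm a) \<and> (range \<phi> = \<real> \<or> range \<phi> = UNIV)"

instance real :: real_or_complex
proof
  have "range complex_of_real = \<real>"
    by (simp add: Reals_def)
  then show "\<exists>\<phi> :: real \<Rightarrow> complex. (\<forall>a b. \<phi> (a + b) = \<phi> a + \<phi> b) \<and> (\<forall>r a. \<phi> (r *\<^sub>R a) = r *\<^sub>R \<phi> a) \<and>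
       (\<forall>a b. \<phi> (a * b) = \<phi> a * \<phi> b) \<and>
       (\<forall>a. norm (\<phi> a) = norm a) \<and> (range \<phi> = \<real> \<or> range \<phi> = UNIV)"
    by (intro exI[of _ complex_of_real]) (auto simp: scaleR_conv_of_real)
qed

instance complex :: real_or_complex
proof
  show "\<exists>\<phi> :: complex \<Rightarrow> complex. (\<forall>a b. \<phi> (a + b) = \<phi> a + \<phi> b) \<and> (\<forall>r a. \<phi> (r *\<^sub>R a) = r *\<^sub>R \<phi> a) \<and>
       (\<forall>a b. \<phi> (a * b) = \<phi> a * \<phi> b) \<and>
       (\<forall>a. norm (\<phi> a) = norm a) \<and> (range \<phi> = \<real> \<or> range \<phi> = UNIV)"
    by (intro exI[of _ id]) auto
qed

text \<open>Closed subspaces and their iterated duals are not types, so normed spaces are given by a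
  carrier set, a scalar multiplication and a norm; addition is that of the surrounding type,
  which for duals is the pointwise addition of functions.\<close>

record ('k, 'v) nspace =
  car :: "'v set"
  scl :: "'k \<Rightarrow> 'v \<Rightarrow> 'v"
  nrm :: "'v \<Rightarrow> real"

definition type_space :: "('k \<Rightarrow> 'a \<Rightarrow> 'a) \<Rightarrow> ('k, 'a::real_normed_vector) nspace"
  where "type_space sc = \<lparr>car = UNIV, scl = sc, nrm = norm\<rparr>"

definition subspace_of :: "('k, 'v) nspace \<Rightarrow> 'v set \<Rightarrow> ('k, 'v) nspace"
  where "subspace_of X M = X\<lparr>car := M\<rparr>"

text \<open>Functionals on the carrier are represented uniquely by giving them the value 0 outside.\<close>

definition dual :: "('k::real_normed_field, 'v::ab_group_add) nspace \<Rightarrow> ('k, 'v \<Rightarrow> 'k) nspace"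
  where "dual X =
    \<lparr>car = {f. (\<forall>x\<in>car X. \<forall>y\<in>car X. f (x + y) = f x + f y) \<and>
               (\<forall>c. \<forall>x\<in>car X. f (scl X c x) = c * f x) \<and>
               (\<exists>B. \<forall>x\<in>car X. norm (f x) \<le> B * nrm X x) \<and>
               (\<forall>x. x \<notin> car X \<longrightarrow> f x = 0)},
     scl = (\<lambda>c f x. c * f x),
     nrm = (\<lambda>f. SUP x\<in>{x \<in> car X. nrm X x \<le> 1}. norm (f x))\<rparr>"

lemma car_dual_scaleR: "car (dual (type_space scaleR)) = {f :: 'a::real_normed_vector \<Rightarrow> real. bounded_linear f}"
  by (auto simp: dual_def type_space_def bounded_linear_def bounded_linear_axioms_def
      linear_iff mult.commute)

lemma nrm_dual_scaleR:
  fixes f :: "'a::real_normed_vector \<Rightarrow> real"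
  assumes "bounded_linear f"
  shows "nrm (dual (type_space scaleR)) f = onorm f"
proof -
  interpret bounded_linear f by fact
  have le: "norm (f x) \<le> onorm f" if "norm x \<le> 1" for x
    using onorm[OF assms, of x] mult_left_mono[OF that onorm_pos_le[OF assms]] by simp
  have bdd: "bdd_above ((\<lambda>x. norm (f x)) ` {x. norm x \<le> 1})"
    using le by (auto intro!: bdd_aboveI2)
  have "onorm f \<le> (SUP x\<in>{x. norm x \<le> 1}. norm (f x))" (is "_ \<le> ?S")
  proof (rule onorm_bound)
    show "0 \<le> ?S"
      by (rule cSUP_upper2[OF bdd, of 0]) auto
    fix x
    show "norm (f x) \<le> ?S * norm x"
    proof (cases "x = 0")
      case False
      have "norm (f (x /\<^sub>R norm x)) \<le> ?S"
        using False by (intro cSUP_upper[OF _ bdd]) auto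
      then show ?thesis
        using False by (simp add: scaleR field_simps abs_mult)
    qed simp
  qed
  moreover have "?S \<le> onorm f"
    by (rule cSUP_least) (auto intro!: le exI[of _ 0] simp del: real_norm_def)
  ultimately show ?thesis
    by (simp add: dual_def type_space_def)
qed

definition canonical :: "('k::real_normed_field, 'v::ab_group_add) nspace \<Rightarrow> 'v \<Rightarrow> ('v \<Rightarrow> 'k) \<Rightarrow> 'k"
  where "canonical X x = (\<lambda>f. if f \<in> car (dual X) then f x else 0)"

definition smooth_point :: "('k::real_normed_field, 'v::ab_group_add) nspace \<Rightarrow> 'v \<Rightarrow> bool"
  where "smooth_point X x \<longleftrightarrow> x \<in> car X \<and> nrm X x = 1 \<and>
    (\<exists>!f. f \<in> car (dual X) \<and> nrm (dual X) f = 1 \<and> f x = 1)"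

definition very_smooth_point :: "('k::real_normed_field, 'v::ab_group_add) nspace \<Rightarrow> 'v \<Rightarrow> bool"
  where "very_smooth_point X x \<longleftrightarrow> x \<in> car X \<and> nrm X x = 1 \<and>
    smooth_point (dual (dual X)) (canonical X x)"

definition annihilator ::
  "('k::real_normed_field, 'v::ab_group_add) nspace \<Rightarrow> 'v set \<Rightarrow> ('v \<Rightarrow> 'k) set"
  where "annihilator X M = {f \<in> car (dual X). \<forall>x\<in>M. f x = 0}"

definition linear_projection :: "('k, 'v::ab_group_add) nspace \<Rightarrow> ('v \<Rightarrow> 'v) \<Rightarrow> bool"
  where "linear_projection X P \<longleftrightarrow>
    (\<forall>x\<in>car X. P x \<in> car X \<and> P (P x) = P x) \<and>
    (\<forall>x\<in>car X. \<forall>y\<in>car X. P (x + y) = P x + P y) \<and>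
    (\<forall>c. \<forall>x\<in>car X. P (scl X c x) = scl X c (P x))"

definition M_ideal :: "('k::real_normed_field, 'v::ab_group_add) nspace \<Rightarrow> 'v set \<Rightarrow> bool"
  where "M_ideal X M \<longleftrightarrow> (\<exists>P. linear_projection (dual X) P \<and>
    (\<forall>f\<in>car (dual X). nrm (dual X) (P f) + nrm (dual X) (f - P f) = nrm (dual X) f) \<and>
    {f \<in> car (dual X). P f = 0} = annihilator X M)"

end

theory Submission
  imports Defs
begin

text \<open>
  A closed subspace \<open>M\<close> of \<open>X\<close> gives, by transposing the inclusion twice, a map
  \<open>M\<^sup>*\<^sup>* \<rightarrow> X\<^sup>*\<^sup>*\<close> that agrees with the inclusion on the canonical images of points of \<open>M\<close>. Since
  every functional on \<open>M\<close> extends to \<open>X\<close> with the same norm (\<open>Hahn_Banach_isometric\<close>), this map is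
  isometric (\<open>bidual_map_isometric\<close>). Both implications thus compare smooth points of \<open>M\<^sup>*\<^sup>*\<close> and of
  \<open>X\<^sup>*\<^sup>*\<close> along an isometric embedding.

  Smoothness always passes down along an isometric embedding (\<open>smooth_point_restrict\<close>): two
  different norming functionals on the smaller space would extend to two different norming
  functionals on the larger one.

  If \<open>M\<close> is an \<open>M\<close>-ideal, then \<open>X\<^sup>*\<close> is the \<open>\<ell>\<^sub>1\<close>-sum of \<open>P X\<^sup>*\<close> and \<open>M\<^sup>\<bottom>\<close>, and the first summand is
  isometric to \<open>M\<^sup>*\<close> because \<open>P g\<close> depends only on the restriction of \<open>g\<close> to \<open>M\<close>
  (\<open>M_ideal_lifting\<close>). Dually, \<open>M\<^sup>*\<^sup>*\<close> is a summand of an \<open>\<ell>\<^sub>\<infinity>\<close>-decomposition of \<open>X\<^sup>*\<^sup>*\<close>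
  (\<open>M_ideal_smooth_point_bidual\<close>). A functional that norms a unit vector of such a summand has to
  vanish on the complementary summand, so it is determined by its restriction to \<open>M\<^sup>*\<^sup>*\<close>, and
  smoothness passes up (\<open>smooth_point_extend\<close>).
\<close>


section \<open>Seminormed spaces and their duals\<close>

text \<open>The scalar multiplication makes the whole type a vector space, also in the case of iterated
  duals, so the carrier is an ordinary linear subspace and only the norm is relative to it.\<close>

locale seminormed_space = vector_space "scl X"
  for X :: "('k::real_normed_field, 'v::ab_group_add) nspace" +
  assumes subspace_car: "subspace (car X)"
    and nrm_triangle: "x \<in> car X \<Longrightarrow> y \<in> car X \<Longrightarrow> nrm X (x + y) \<le> nrm X x + nrm X y"
    and nrm_scl: "x \<in> car X \<Longrightarrow> nrm X (scl X c x) = norm c * nrm X x"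
begin

lemma zero_car: "0 \<in> car X"
  by (rule subspace_0[OF subspace_car])

lemma add_car: "x \<in> car X \<Longrightarrow> y \<in> car X \<Longrightarrow> x + y \<in> car X"
  by (rule subspace_add[OF subspace_car])

lemma diff_car: "x \<in> car X \<Longrightarrow> y \<in> car X \<Longrightarrow> x - y \<in> car X"
  by (rule subspace_diff[OF subspace_car])

lemma scl_car: "x \<in> car X \<Longrightarrow> scl X c x \<in> car X"
  by (rule subspace_scale[OF subspace_car])

lemma nrm_zero: "nrm X 0 = 0"
  using nrm_scl[OF zero_car, of 0] by simp

lemma nrm_nonneg:
  assumes "x \<in> car X"
  shows "0 \<le> nrm X x"
proof -
  have "nrm X (x + scl X (-1) x) \<le> nrm X x + nrm X (scl X (-1) x)"
    by (rule nrm_triangle[OF assms scl_car[OF assms]])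
  then show ?thesis
    using nrm_zero nrm_scl[OF assms, of "-1"] by simp
qed

lemma dual_add: "f \<in> car (dual X) \<Longrightarrow> x \<in> car X \<Longrightarrow> y \<in> car X \<Longrightarrow> f (x + y) = f x + f y"
  by (simp add: dual_def)

lemma dual_scl: "f \<in> car (dual X) \<Longrightarrow> x \<in> car X \<Longrightarrow> f (scl X c x) = c * f x"
  by (simp add: dual_def)

lemma dual_diff:
  assumes "f \<in> car (dual X)" "x \<in> car X" "y \<in> car X"
  shows "f (x - y) = f x - f y"
  using dual_add[OF assms(1) diff_car[OF assms(2,3)] assms(3)] by simp

lemma dual_outside: "f \<in> car (dual X) \<Longrightarrow> x \<notin> car X \<Longrightarrow> f x = 0"
  by (simp add: dual_def)

lemma dual_eqI:
  assumes "f \<in> car (dual X)" "g \<in> car (dual X)" "\<And>x. x \<in> car X \<Longrightarrow> f x = g x"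
  shows "f = g"
proof
  fix x
  show "f x = g x"
    using assms(3) dual_outside[OF assms(1)] dual_outside[OF assms(2)] by (cases "x \<in> car X") auto
qed

lemma dualI:
  assumes "\<And>x y. x \<in> car X \<Longrightarrow> y \<in> car X \<Longrightarrow> f (x + y) = f x + f y"
    and "\<And>c x. x \<in> car X \<Longrightarrow> f (scl X c x) = c * f x"
    and "\<And>x. x \<in> car X \<Longrightarrow> norm (f x) \<le> B * nrm X x"
    and "\<And>x. x \<notin> car X \<Longrightarrow> f x = 0"
  shows "f \<in> car (dual X)"
proof -
  have "\<exists>B. \<forall>x\<in>car X. norm (f x) \<le> B * nrm X x"
    by (intro exI[of _ B] ballI assms(3))
  then show ?thesis
    using assms(1,2,4) by (simp add: dual_def)
qed

lemma dual_bounded: "f \<in> car (dual X) \<Longrightarrow> \<exists>B. \<forall>x\<in>car X. norm (f x) \<le> B * nrm X x"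
  by (simp add: dual_def)

lemma dual_nrm_le:
  assumes "\<And>x. x \<in> car X \<Longrightarrow> norm (f x) \<le> B * nrm X x" and "0 \<le> B"
  shows "nrm (dual X) f \<le> B"
proof -
  have "(SUP x\<in>{x \<in> car X. nrm X x \<le> 1}. norm (f x)) \<le> B"
  proof (rule cSUP_least)
    show "{x \<in> car X. nrm X x \<le> 1} \<noteq> {}"
      using zero_car nrm_zero by force
    fix x assume x: "x \<in> {x \<in> car X. nrm X x \<le> 1}"
    then have "norm (f x) \<le> B * nrm X x"
      using assms(1) by simp
    also have "\<dots> \<le> B * 1"
      using x \<open>0 \<le> B\<close> by (intro mult_left_mono) auto
    finally show "norm (f x) \<le> B" by simp
  qed
  then show ?thesis by (simp add: dual_def)
qed

lemma dual_unit_ball: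
  assumes f: "f \<in> car (dual X)" and x: "x \<in> car X" "nrm X x \<le> 1"
  shows "norm (f x) \<le> nrm (dual X) f"
proof -
  obtain B where B: "\<forall>x\<in>car X. norm (f x) \<le> B * nrm X x"
    using dual_bounded[OF f] ..
  have "norm (f y) \<le> \<bar>B\<bar>" if "y \<in> {x \<in> car X. nrm X x \<le> 1}" for y
  proof -
    have "norm (f y) \<le> B * nrm X y"
      using that B by simp
    also have "\<dots> \<le> \<bar>B\<bar> * 1"
      using that nrm_nonneg by (intro mult_mono) auto
    finally show ?thesis by simp
  qed
  then have "bdd_above ((\<lambda>x. norm (f x)) ` {x \<in> car X. nrm X x \<le> 1})"
    by (rule bdd_aboveI2)
  then have "norm (f x) \<le> (SUP x\<in>{x \<in> car X. nrm X x \<le> 1}. norm (f x))"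
    using x by (intro cSUP_upper) auto
  then show ?thesis by (simp add: dual_def)
qed

lemma dual_nrm_nonneg: "f \<in> car (dual X) \<Longrightarrow> 0 \<le> nrm (dual X) f"
  using order_trans[OF norm_ge_zero dual_unit_ball[of f 0]] by (simp add: zero_car nrm_zero)

lemma dual_bound:
  assumes f: "f \<in> car (dual X)" and x: "x \<in> car X"
  shows "norm (f x) \<le> nrm (dual X) f * nrm X x"
proof (cases "nrm X x = 0")
  case True
  \<comment> \<open>Here \<open>x\<close> cannot be normalised, but boundedness of \<open>f\<close> forces \<open>f x = 0\<close>.\<close>
  obtain B where "\<forall>x\<in>car X. norm (f x) \<le> B * nrm X x"
    using dual_bounded[OF f] ..
  with x True show ?thesis by auto
next
  case False
  then have pos: "0 < nrm X x"
    using nrm_nonneg[OF x] by simp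
  let ?y = "scl X (of_real (1 / nrm X x)) x"
  have "norm (f ?y) \<le> nrm (dual X) f"
    using pos by (intro dual_unit_ball[OF f]) (simp_all add: scl_car nrm_scl x norm_divide)
  then have "norm (f ?y) * nrm X x \<le> nrm (dual X) f * nrm X x"
    using pos by (intro mult_right_mono) auto
  moreover have "norm (f ?y) * nrm X x = norm (f x)"
    using pos by (subst dual_scl[OF f x]) (simp add: norm_mult norm_divide)
  ultimately show ?thesis by simp
qed

text \<open>Duals are again seminormed spaces, so that all results can be applied to iterated duals.\<close>

lemma seminormed_space_dual: "seminormed_space (dual X)"
proof -
  have scl: "scl (dual X) = (\<lambda>c f x. c * f x)"
    by (simp add: dual_def)
  have vs: "vector_space (scl (dual X))"
    unfolding scl by unfold_locales (auto simp: algebra_simps)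
  interpret D: vector_space "scl (dual X)" by (fact vs)
  have zero: "0 \<in> car (dual X)"
    by (rule dualI[where B = 0]) auto
  have add_bound: "norm ((f + g) x) \<le> (nrm (dual X) f + nrm (dual X) g) * nrm X x"
    if "f \<in> car (dual X)" "g \<in> car (dual X)" "x \<in> car X" for f g x
    using norm_triangle_le[OF add_mono[OF dual_bound[OF that(1,3)] dual_bound[OF that(2,3)]]]
    by (simp add: algebra_simps)
  have scl_bound: "norm (scl (dual X) c f x) \<le> (norm c * nrm (dual X) f) * nrm X x"
    if "f \<in> car (dual X)" "x \<in> car X" for c f x
    using mult_left_mono[OF dual_bound[OF that], of "norm c"]
    by (simp add: scl norm_mult mult.assoc)
  have add: "f + g \<in> car (dual X)" if "f \<in> car (dual X)" "g \<in> car (dual X)" for f g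
    by (rule dualI[OF _ _ add_bound[OF that]])
      (use that in \<open>auto simp: dual_add dual_scl dual_outside algebra_simps\<close>)
  have scale: "scl (dual X) c f \<in> car (dual X)" if "f \<in> car (dual X)" for c f
    by (rule dualI[OF _ _ scl_bound[OF that]])
      (use that in \<open>auto simp: scl dual_add dual_scl dual_outside algebra_simps\<close>)
  have scale_le: "nrm (dual X) (scl (dual X) c f) \<le> norm c * nrm (dual X) f"
    if "f \<in> car (dual X)" for c f
    by (rule dual_nrm_le[OF scl_bound[OF that]]) (auto simp: that dual_nrm_nonneg)
  show ?thesis
  proof (intro seminormed_space.intro vs seminormed_space_axioms.intro)
    show "D.subspace (car (dual X))"
      by (intro D.subspaceI zero add scale)
  next
    fix f g assume fg: "f \<in> car (dual X)" "g \<in> car (dual X)"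
    show "nrm (dual X) (f + g) \<le> nrm (dual X) f + nrm (dual X) g"
      by (rule dual_nrm_le[OF add_bound[OF fg]]) (auto simp: fg dual_nrm_nonneg)
  next
    fix f and c :: 'k assume f: "f \<in> car (dual X)"
    show "nrm (dual X) (scl (dual X) c f) = norm c * nrm (dual X) f"
    proof (cases "c = 0")
      case True
      then show ?thesis
        using scale_le[OF f, of 0] dual_nrm_nonneg[OF scale[OF f, of 0]] by simp
    next
      case False
      \<comment> \<open>The reverse inequality follows by applying the first one to the inverse scalar.\<close>
      have "f = scl (dual X) (inverse c) (scl (dual X) c f)"
        using False by (simp add: scl fun_eq_iff)
      then have "nrm (dual X) f \<le> norm (inverse c) * nrm (dual X) (scl (dual X) c f)"
        using scale_le[OF scale[OF f, of c], of "inverse c"] by simp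
      from mult_left_mono[OF this norm_ge_zero[of c]]
      have "norm c * nrm (dual X) f
          \<le> norm c * (norm (inverse c) * nrm (dual X) (scl (dual X) c f))" .
      also have "\<dots> = nrm (dual X) (scl (dual X) c f)"
        using False by (simp add: norm_inverse)
      finally show ?thesis
        using scale_le[OF f, of c] by simp
    qed
  qed
qed

lemma seminormed_space_subspace_of:
  assumes "subspace M" "M \<subseteq> car X"
  shows "seminormed_space (subspace_of X M)"
proof -
  have eq: "scl (subspace_of X M) = scl X" "nrm (subspace_of X M) = nrm X"
    "car (subspace_of X M) = M"
    by (simp_all add: subspace_of_def)
  show ?thesis
    unfolding seminormed_space_def seminormed_space_axioms_def eq
    using assms nrm_triangle nrm_scl vector_space_axioms by blast
qed

lemma canonical_in_bidual:
  assumes x: "x \<in> car X"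
  shows "canonical X x \<in> car (dual (dual X))"
proof -
  interpret D: seminormed_space "dual X" by (rule seminormed_space_dual)
  have b: "norm (canonical X x f) \<le> nrm X x * nrm (dual X) f" if "f \<in> car (dual X)" for f
    using dual_bound[OF that x] that by (simp add: canonical_def mult.commute)
  show ?thesis
    by (rule D.dualI[OF _ _ b])
      (simp_all add: canonical_def D.add_car D.scl_car, simp add: dual_def)
qed

end

lemma seminormed_space_type_space:
  assumes "vector_space sc" "\<And>c x. norm (sc c x) = norm c * norm x"
  shows "seminormed_space (type_space sc)"
proof -
  interpret vector_space sc by fact
  show ?thesis
    unfolding seminormed_space_def seminormed_space_axioms_def
    using assms by (auto simp: type_space_def norm_triangle_ineq)
qed


section \<open>Contractions and their adjoints\<close>

definition contraction ::
  "('k::real_normed_field, 'v::ab_group_add) nspace \<Rightarrow> ('k, 'w::ab_group_add) nspace \<Rightarrow> ('v \<Rightarrow> 'w) \<Rightarrow> bool"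
  where "contraction Y Z T \<longleftrightarrow>
    (\<forall>y\<in>car Y. T y \<in> car Z \<and> nrm Z (T y) \<le> nrm Y y) \<and>
    (\<forall>y\<in>car Y. \<forall>y'\<in>car Y. T (y + y') = T y + T y') \<and>
    (\<forall>c. \<forall>y\<in>car Y. T (scl Y c y) = scl Z c (T y))"

definition isometric_embedding ::
  "('k::real_normed_field, 'v::ab_group_add) nspace \<Rightarrow> ('k, 'w::ab_group_add) nspace \<Rightarrow> ('v \<Rightarrow> 'w) \<Rightarrow> bool"
  where "isometric_embedding Y Z T \<longleftrightarrow> contraction Y Z T \<and> (\<forall>y\<in>car Y. nrm Z (T y) = nrm Y y)"

definition dual_map ::
  "('k::real_normed_field, 'v::ab_group_add) nspace \<Rightarrow> ('v \<Rightarrow> 'w) \<Rightarrow> ('w \<Rightarrow> 'k) \<Rightarrow> 'v \<Rightarrow> 'k"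
  where "dual_map Y T f = (\<lambda>y. if y \<in> car Y then f (T y) else 0)"

lemma contractionD:
  assumes "contraction Y Z T" "y \<in> car Y"
  shows "T y \<in> car Z" "nrm Z (T y) \<le> nrm Y y" "y' \<in> car Y \<Longrightarrow> T (y + y') = T y + T y'"
    "T (scl Y c y) = scl Z c (T y)"
  using assms by (auto simp: contraction_def)

lemma dual_map_contraction:
  assumes "seminormed_space Y" "seminormed_space Z" and T: "contraction Y Z T"
  shows "contraction (dual Z) (dual Y) (dual_map Y T)"
proof -
  interpret Y: seminormed_space Y by fact
  interpret Z: seminormed_space Z by fact
  note T' = contractionD[OF T]
  have b: "norm (dual_map Y T f y) \<le> nrm (dual Z) f * nrm Y y"
    if f: "f \<in> car (dual Z)" and y: "y \<in> car Y" for f y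
  proof -
    have "norm (dual_map Y T f y) \<le> nrm (dual Z) f * nrm Z (T y)"
      using Z.dual_bound[OF f T'(1)[OF y]] y by (simp add: dual_map_def)
    also have "\<dots> \<le> nrm (dual Z) f * nrm Y y"
      by (intro mult_left_mono T'(2) y Z.dual_nrm_nonneg f)
    finally show ?thesis .
  qed
  have "dual_map Y T f \<in> car (dual Y)" if f: "f \<in> car (dual Z)" for f
    by (rule Y.dualI[OF _ _ b[OF f]])
      (auto simp: dual_map_def Y.add_car Y.scl_car T' Z.dual_add[OF f] Z.dual_scl[OF f])
  moreover have "nrm (dual Y) (dual_map Y T f) \<le> nrm (dual Z) f" if f: "f \<in> car (dual Z)" for f
    by (rule Y.dual_nrm_le[OF b[OF f] Z.dual_nrm_nonneg[OF f]])
  ultimately show ?thesis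
    unfolding contraction_def by (auto simp: dual_map_def dual_def fun_eq_iff)
qed


section \<open>The Hahn-Banach theorem\<close>

text \<open>Partial linear functionals below \<open>p\<close>, given by their graphs. Single-valuedness is automatic
  if \<open>p 0 = 0\<close>: a pair \<open>(0, r)\<close> in such a set satisfies \<open>r \<le> p 0\<close> and, by symmetry, \<open>- r \<le> p 0\<close>.\<close>

definition dominated_graph ::
  "(real \<Rightarrow> 'v::ab_group_add \<Rightarrow> 'v) \<Rightarrow> 'v set \<Rightarrow> ('v \<Rightarrow> real) \<Rightarrow> ('v \<times> real) set \<Rightarrow> bool"
  where "dominated_graph s V p G \<longleftrightarrow> (0, 0) \<in> G \<and>
    (\<forall>x r y q. (x, r) \<in> G \<longrightarrow> (y, q) \<in> G \<longrightarrow> (x + y, r + q) \<in> G) \<and>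
    (\<forall>t x r. (x, r) \<in> G \<longrightarrow> (s t x, t * r) \<in> G) \<and>
    (\<forall>x r. (x, r) \<in> G \<longrightarrow> x \<in> V \<and> r \<le> p x)"

lemma dominated_graphD:
  assumes "dominated_graph s V p G"
  shows "(0, 0) \<in> G"
    and "(x, r) \<in> G \<Longrightarrow> (y, q) \<in> G \<Longrightarrow> (x + y, r + q) \<in> G"
    and "(x, r) \<in> G \<Longrightarrow> (s t x, t * r) \<in> G"
    and "(x, r) \<in> G \<Longrightarrow> x \<in> V" and "(x, r) \<in> G \<Longrightarrow> r \<le> p x"
  using assms by (auto simp: dominated_graph_def)

text \<open>The one-dimensional extension step: any value \<open>c\<close> between \<open>r - p (x - z)\<close> and
  \<open>p (x + z) - r\<close> for all \<open>(x, r)\<close> in the graph may be assigned to the new vector \<open>z\<close>, and there is one because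
  \<open>r + q \<le> p (x + y) \<le> p (x - z) + p (y + z)\<close> for all \<open>(x, r)\<close> and \<open>(y, q)\<close> in the graph.\<close>

lemma dominated_graph_extend:
  assumes "vector_space s" and V: "module.subspace s V"
    and sub: "\<And>x y. x \<in> V \<Longrightarrow> y \<in> V \<Longrightarrow> p (x + y) \<le> p x + p y"
    and hom: "\<And>t x. x \<in> V \<Longrightarrow> 0 \<le> t \<Longrightarrow> p (s t x) = t * p x"
    and G: "dominated_graph s V p G" and z: "z \<in> V"
  obtains H c where "dominated_graph s V p H" "G \<subseteq> H" "(z, c) \<in> H"
proof -
  interpret vector_space s by fact
  note G' = dominated_graphD[OF G]
  note V' = subspace_add[OF V] subspace_diff[OF V] subspace_scale[OF V]
  have cross: "r - p (x - z) \<le> p (y + z) - q" if "(x, r) \<in> G" "(y, q) \<in> G" for x r y q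
  proof -
    have "r + q \<le> p (x + y)"
      using G'(2,5) that by blast
    also have "x + y = (x - z) + (y + z)" by simp
    also have "p \<dots> \<le> p (x - z) + p (y + z)"
      using that G'(4) z by (intro sub V')
    finally show ?thesis by simp
  qed
  define c where "c = (SUP (x, r)\<in>G. r - p (x - z))"
  have bdd: "bdd_above ((\<lambda>(x, r). r - p (x - z)) ` G)"
    by (rule bdd_aboveI2[where M = "p (0 + z) - 0"]) (use cross[OF _ G'(1)] in auto)
  have lower: "r - p (x - z) \<le> c" if "(x, r) \<in> G" for x r
    unfolding c_def using cSUP_upper[OF that bdd] by simp
  have upper: "c \<le> p (y + z) - q" if "(y, q) \<in> G" for y q
    unfolding c_def using G'(1) cross[OF _ that] by (intro cSUP_least) auto
  define H where "H = {(x + s t z, r + t * c) | x r t. (x, r) \<in> G}"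
  have dom: "r + t * c \<le> p (x + s t z)" if xr: "(x, r) \<in> G" for x r t
  proof (cases t "0::real" rule: linorder_cases)
    case equal
    then show ?thesis using G'(5)[OF xr] by simp
  next
    case greater
    have "(1 / t) * r + c \<le> p (s (1 / t) x + z)"
      using upper[OF G'(3)[OF xr, of "1 / t"]] by simp
    then have "t * ((1 / t) * r + c) \<le> t * p (s (1 / t) x + z)"
      using greater by (intro mult_left_mono) auto
    also have "\<dots> = p (s t (s (1 / t) x + z))"
      by (rule hom[symmetric]) (use greater in \<open>auto intro: V' G'(4)[OF xr] z\<close>)
    also have "s t (s (1 / t) x + z) = x + s t z"
      using greater by (simp add: scale_right_distrib)
    finally show ?thesis
      using greater by (simp add: algebra_simps)
  next
    case less
    have "(1 / - t) * r - c \<le> p (s (1 / - t) x - z)"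
      using lower[OF G'(3)[OF xr, of "1 / - t"]] by simp
    then have "- t * ((1 / - t) * r - c) \<le> - t * p (s (1 / - t) x - z)"
      using less by (intro mult_left_mono) auto
    also have "\<dots> = p (s (- t) (s (1 / - t) x - z))"
      by (rule hom[symmetric]) (intro V' G'(4)[OF xr] z, use less in simp)
    also have "s (- t) (s (1 / - t) x - z) = x + s t z"
      using less by (simp add: scale_right_diff_distrib)
    finally show ?thesis
      using less by (simp add: algebra_simps)
  qed
  have HI: "(x', r') \<in> H" if "(x, r) \<in> G" "x' = x + s t z" "r' = r + t * c" for x r t x' r'
    unfolding H_def using that by blast
  have "dominated_graph s V p H"
    unfolding dominated_graph_def
  proof (intro conjI allI impI)
    show "(0, 0) \<in> H"
      by (rule HI[OF G'(1), where t = 0]) auto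
  next
    fix x r y q assume "(x, r) \<in> H" "(y, q) \<in> H"
    then obtain x1 r1 t1 y1 q1 t2 where *: "(x1, r1) \<in> G" "(y1, q1) \<in> G"
      "x = x1 + s t1 z" "r = r1 + t1 * c" "y = y1 + s t2 z" "q = q1 + t2 * c"
      unfolding H_def by blast
    show "(x + y, r + q) \<in> H"
      by (rule HI[OF G'(2)[OF *(1,2)], where t = "t1 + t2"])
        (auto simp: * scale_left_distrib algebra_simps)
  next
    fix u x r assume "(x, r) \<in> H"
    then obtain x1 r1 t where *: "(x1, r1) \<in> G" "x = x1 + s t z" "r = r1 + t * c"
      unfolding H_def by blast
    show "(s u x, u * r) \<in> H"
      by (rule HI[OF G'(3)[OF *(1)], where t = "u * t"])
        (auto simp: * scale_right_distrib algebra_simps)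
  next
    fix x r assume "(x, r) \<in> H"
    then obtain x1 r1 t where *: "(x1, r1) \<in> G" "x = x1 + s t z" "r = r1 + t * c"
      unfolding H_def by blast
    show "x \<in> V" using * G'(4) z by (auto intro!: V')
    show "r \<le> p x" using dom * by simp
  qed
  moreover have "G \<subseteq> H"
    by (auto intro!: HI[where t = 0])
  moreover have "(z, c) \<in> H"
    by (rule HI[OF G'(1), where t = 1]) auto
  ultimately show thesis by (rule that)
qed

text \<open>By Zorn's lemma there is a maximal dominated graph above \<open>G\<close>, and by the extension step a
  maximal one is defined on all of \<open>V\<close>.\<close>

theorem real_Hahn_Banach:
  assumes "vector_space s" and V: "module.subspace s V"
    and sub: "\<And>x y. x \<in> V \<Longrightarrow> y \<in> V \<Longrightarrow> p (x + y) \<le> p x + p y"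
    and hom: "\<And>t x. x \<in> V \<Longrightarrow> 0 \<le> t \<Longrightarrow> p (s t x) = t * p x"
    and G: "dominated_graph s V p G"
  obtains U where "\<And>x r. (x, r) \<in> G \<Longrightarrow> U x = r" "\<And>x. x \<in> V \<Longrightarrow> U x \<le> p x"
    "\<And>x y. x \<in> V \<Longrightarrow> y \<in> V \<Longrightarrow> U (x + y) = U x + U y"
    "\<And>t x. x \<in> V \<Longrightarrow> U (s t x) = t * U x"
proof -
  interpret vector_space s by fact
  let ?A = "{H. dominated_graph s V p H \<and> G \<subseteq> H}"
  have "\<exists>H\<in>?A. \<forall>K\<in>?A. H \<subseteq> K \<longrightarrow> K = H"
  proof (rule subset_Zorn_nonempty)
    show "?A \<noteq> {}" using G by auto
    fix C assume "C \<noteq> {}" and C: "subset.chain ?A C"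
    have graph: "dominated_graph s V p H" "G \<subseteq> H" if "H \<in> C" for H
      using C that by (auto simp: subset.chain_def)
    have common: "\<exists>H\<in>C. (x, r) \<in> H \<and> (y, q) \<in> H"
      if xr: "(x, r) \<in> \<Union>C" and yq: "(y, q) \<in> \<Union>C" for x r y q
    proof -
      obtain H K where "H \<in> C" "K \<in> C" "(x, r) \<in> H" "(y, q) \<in> K"
        using xr yq by blast
      moreover from this have "H \<subseteq> K \<or> K \<subseteq> H"
        using C unfolding subset_chain_def by blast
      ultimately show ?thesis by blast
    qed
    have "dominated_graph s V p (\<Union>C)"
      unfolding dominated_graph_def
    proof (intro conjI allI impI)
      show "(0, 0) \<in> \<Union>C"
        using \<open>C \<noteq> {}\<close> dominated_graphD(1)[OF graph(1)] by blast
    next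
      fix x r y q assume "(x, r) \<in> \<Union>C" "(y, q) \<in> \<Union>C"
      then show "(x + y, r + q) \<in> \<Union>C"
        using common dominated_graphD(2)[OF graph(1)] by blast
    next
      fix t x r assume "(x, r) \<in> \<Union>C"
      then show "(s t x, t * r) \<in> \<Union>C"
        using dominated_graphD(3)[OF graph(1)] by blast
    next
      fix x r assume "(x, r) \<in> \<Union>C"
      then show "x \<in> V" "r \<le> p x"
        using dominated_graphD(4,5)[OF graph(1)] by blast+
    qed
    then show "\<Union>C \<in> ?A"
      using \<open>C \<noteq> {}\<close> graph(2) by blast
  qed
  then obtain H where H: "dominated_graph s V p H" "G \<subseteq> H"
    and max: "\<And>K. dominated_graph s V p K \<Longrightarrow> G \<subseteq> K \<Longrightarrow> H \<subseteq> K \<Longrightarrow> K = H"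
    by auto
  note H' = dominated_graphD[OF H(1)]
  have total: "\<exists>r. (x, r) \<in> H" if x: "x \<in> V" for x
  proof -
    obtain K c where K: "dominated_graph s V p K" "H \<subseteq> K" "(x, c) \<in> K"
      by (rule dominated_graph_extend[OF assms(1) V sub hom H(1) x])
    then have "K = H" using max H(2) by blast
    then show ?thesis using K(3) by blast
  qed
  have unique: "r = q" if "(x, r) \<in> H" "(x, q) \<in> H" for x r q
  proof -
    have "p 0 = 0"
      using hom[OF subspace_0[OF V], of 0] by simp
    moreover have "a - b \<le> p 0" if "(x, a) \<in> H" "(x, b) \<in> H" for a b
      using H'(5)[OF H'(2)[OF that(1) H'(3)[OF that(2), of "-1"]]] by simp
    ultimately show ?thesis
      using that by (metis antisym diff_le_0_iff_le)
  qed
  define U where "U x = (THE r. (x, r) \<in> H)" for x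
  have UI: "U x = r" if "(x, r) \<in> H" for x r
    unfolding U_def using that unique by blast
  have UH: "(x, U x) \<in> H" if "x \<in> V" for x
    using total[OF that] UI by blast
  show thesis
  proof (rule that[of U])
    show "U x = r" if "(x, r) \<in> G" for x r
      using that H(2) UI by blast
    show "U x \<le> p x" if "x \<in> V" for x
      using H'(5)[OF UH[OF that]] .
    show "U (x + y) = U x + U y" if "x \<in> V" "y \<in> V" for x y
      by (rule UI[OF H'(2)[OF UH[OF that(1)] UH[OF that(2)]]])
    show "U (s t x) = t * U x" if "x \<in> V" for t x
      by (rule UI[OF H'(3)[OF UH[OF that]]])
  qed
qed

text \<open>Real and complex scalars are treated uniformly by means of \<open>J\<close>, which is the imaginary
  unit in the complex case and \<open>0\<close> in the real case.\<close>

lemma real_or_complex_parts: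
  obtains re :: "'k::real_or_complex \<Rightarrow> real" and J :: 'k where
    "\<And>a b. re (a + b) = re a + re b" "\<And>r a. re (of_real r * a) = r * re a"
    "\<And>a. re a \<le> norm a" "re 1 = 1" "re J = 0" "J = 0 \<or> J * J = -1"
    "\<And>a. a = of_real (re a) - J * of_real (re (J * a))"
proof -
  obtain \<phi> :: "'k \<Rightarrow> complex" where add: "\<And>a b. \<phi> (a + b) = \<phi> a + \<phi> b"
    and scaleR: "\<And>r a. \<phi> (r *\<^sub>R a) = r *\<^sub>R \<phi> a" and mult: "\<And>a b. \<phi> (a * b) = \<phi> a * \<phi> b"
    and norm: "\<And>a. norm (\<phi> a) = norm a" and range: "range \<phi> = \<real> \<or> range \<phi> = UNIV"
    using real_or_complex[where 'a = 'k] by blast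
  have diff: "\<phi> (a - b) = \<phi> a - \<phi> b" for a b
    using add[of "a - b" b] by simp
  have inj: "a = b" if "\<phi> a = \<phi> b" for a b
    using norm[of "a - b"] diff[of a b] that by simp
  have one: "\<phi> 1 = 1"
    using mult[of 1 1] norm[of 1] by auto
  have real: "\<phi> (of_real r) = of_real r" for r
    using scaleR[of r 1] one by (simp add: of_real_def)
  obtain J where J: "(J = 0 \<and> range \<phi> = \<real>) \<or> \<phi> J = \<i>"
    using range by (metis UNIV_I imageE)
  have J2: "J = 0 \<or> J * J = -1"
  proof (rule disjCI)
    assume "J * J \<noteq> -1"
    moreover have "J * J = -1" if "\<phi> J = \<i>"
      by (rule inj) (use real[of "-1"] in \<open>simp add: mult that\<close>)
    ultimately show "J = 0" using J by blast
  qed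
  have reJ: "Re (\<phi> J) = 0"
    using J real[of 0] by auto
  have parts: "a = of_real (Re (\<phi> a)) - J * of_real (Re (\<phi> (J * a)))" for a
  proof (rule inj)
    consider "J = 0" "\<phi> a \<in> \<real>" | "\<phi> J = \<i>"
      using J by auto
    then show "\<phi> a = \<phi> (of_real (Re (\<phi> a)) - J * of_real (Re (\<phi> (J * a))))"
    proof cases
      case 1
      then show ?thesis
        by (simp add: real)
    next
      case 2
      then show ?thesis
        by (simp add: diff add mult real complex_eq_iff)
    qed
  qed
  show thesis
  proof (rule that[of "\<lambda>a. Re (\<phi> a)" J])
    show "Re (\<phi> (a + b)) = Re (\<phi> a) + Re (\<phi> b)" for a b by (simp add: add)
    show "Re (\<phi> (of_real r * a)) = r * Re (\<phi> a)" for r a by (simp add: mult real)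
    show "Re (\<phi> a) \<le> norm a" for a using complex_Re_le_cmod[of "\<phi> a"] by (simp add: norm)
    show "Re (\<phi> 1) = 1" by (simp add: one)
  qed (fact reJ J2 parts)+
qed

text \<open>Extension along an isometric embedding rather than from a subspace, as the bidual of a
  subspace is not a subset of the bidual of the whole space. The real part of \<open>f\<close> is extended
  first, to \<open>U\<close>; then \<open>g\<close> is the only linear functional with real part \<open>U\<close>, and rotating
  a value \<open>g x\<close> to the positive axis shows that \<open>g\<close> inherits the bound of \<open>U\<close>.\<close>

theorem Hahn_Banach_isometric:
  fixes Y :: "('k::real_or_complex, 'v::ab_group_add) nspace"
    and Z :: "('k, 'w::ab_group_add) nspace"
  assumes "seminormed_space Y" "seminormed_space Z" and T: "isometric_embedding Y Z T"
    and f: "f \<in> car (dual Y)"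
  obtains g where "g \<in> car (dual Z)" "nrm (dual Z) g \<le> nrm (dual Y) f" "dual_map Y T g = f"
proof -
  interpret Y: seminormed_space Y by fact
  interpret Z: seminormed_space Z by fact
  have Tc: "contraction Y Z T" and Tn: "\<And>y. y \<in> car Y \<Longrightarrow> nrm Z (T y) = nrm Y y"
    using T by (auto simp: isometric_embedding_def)
  note T' = contractionD[OF Tc]
  obtain re :: "'k \<Rightarrow> real" and J :: 'k where re: "\<And>a b. re (a + b) = re a + re b"
    "\<And>r a. re (of_real r * a) = r * re a" "\<And>a. re a \<le> norm a" "re 1 = 1" "re J = 0"
    and J: "J = 0 \<or> J * J = -1"
    and parts: "\<And>a. a = of_real (re a) - J * of_real (re (J * a))"
    by (rule real_or_complex_parts) blast
  let ?N = "nrm (dual Y) f"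
  have N: "0 \<le> ?N" by (rule Y.dual_nrm_nonneg[OF f])
  let ?s = "\<lambda>r. scl Z (of_real r)"
  let ?p = "\<lambda>x. ?N * nrm Z x"
  let ?G = "{(T y, re (f y)) | y. y \<in> car Y}"
  have vs: "vector_space ?s"
    by unfold_locales (simp_all add: Z.scale_right_distrib Z.scale_left_distrib)
  interpret R: vector_space ?s by (fact vs)
  have sp: "R.subspace (car Z)"
    by (intro R.subspaceI Z.zero_car Z.add_car Z.scl_car)
  have G: "dominated_graph ?s (car Z) ?p ?G"
    unfolding dominated_graph_def
  proof (intro conjI allI impI)
    have "T 0 = 0"
      using T'(4)[OF Y.zero_car, of 0] by simp
    moreover have "re (f 0) = 0"
      using Y.dual_scl[OF f Y.zero_car, of 0] re(2)[of 0 0] by simp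
    ultimately show "(0, 0) \<in> ?G"
      using Y.zero_car by force
  next
    fix x r y q assume "(x, r) \<in> ?G" "(y, q) \<in> ?G"
    then obtain a b where "a \<in> car Y" "b \<in> car Y" "x = T a" "r = re (f a)" "y = T b" "q = re (f b)"
      by blast
    then have "x + y = T (a + b)" "r + q = re (f (a + b))" "a + b \<in> car Y"
      by (simp_all add: T' Y.dual_add[OF f] re Y.add_car)
    then show "(x + y, r + q) \<in> ?G" by blast
  next
    fix t x r assume "(x, r) \<in> ?G"
    then obtain a where "a \<in> car Y" "x = T a" "r = re (f a)"
      by blast
    then have "?s t x = T (scl Y (of_real t) a)" "t * r = re (f (scl Y (of_real t) a))"
      "scl Y (of_real t) a \<in> car Y"
      by (simp_all add: T' Y.dual_scl[OF f] re Y.scl_car)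
    then show "(?s t x, t * r) \<in> ?G" by blast
  next
    fix x r assume "(x, r) \<in> ?G"
    then obtain a where a: "a \<in> car Y" "x = T a" "r = re (f a)"
      by blast
    then show "x \<in> car Z" by (simp add: T')
    show "r \<le> ?p x"
      using re(3)[of "f a"] Y.dual_bound[OF f a(1)] by (simp add: a Tn)
  qed
  obtain U where UG: "\<And>x r. (x, r) \<in> ?G \<Longrightarrow> U x = r"
    and Up: "\<And>x. x \<in> car Z \<Longrightarrow> U x \<le> ?p x"
    and Uadd: "\<And>x y. x \<in> car Z \<Longrightarrow> y \<in> car Z \<Longrightarrow> U (x + y) = U x + U y"
    and Uscl: "\<And>t x. x \<in> car Z \<Longrightarrow> U (?s t x) = t * U x"
  proof (rule real_Hahn_Banach[OF vs sp _ _ G])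
    show "?p (x + y) \<le> ?p x + ?p y" if "x \<in> car Z" "y \<in> car Z" for x y
      using mult_left_mono[OF Z.nrm_triangle[OF that] N] by (simp add: algebra_simps)
    show "?p (?s t x) = t * ?p x" if "x \<in> car Z" "0 \<le> t" for t x
      using that by (simp add: Z.nrm_scl)
  qed blast
  define g where "g x = (if x \<in> car Z then of_real (U x) - J * of_real (U (scl Z J x)) else 0)" for x
  have g_add: "g (x + y) = g x + g y" if "x \<in> car Z" "y \<in> car Z" for x y
    using that by (simp add: g_def Z.add_car Z.scl_car Uadd Z.scale_right_distrib algebra_simps)
  have g_real: "g (?s t x) = of_real t * g x" if x: "x \<in> car Z" for t x
  proof -
    have "scl Z J (?s t x) = ?s t (scl Z J x)"
      by (simp add: mult.commute)
    then show ?thesis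
      using x by (simp add: g_def Z.scl_car Uscl algebra_simps del: Z.scale_scale)
  qed
  have g_J: "g (scl Z J x) = J * g x" if x: "x \<in> car Z" for x
    using J
  proof
    assume "J = 0"
    then show ?thesis
      using Uscl[OF x, of 0] x by (simp add: g_def Z.zero_car)
  next
    assume J: "J * J = -1"
    have "U (scl Z (J * J) x) = - U x"
      using Uscl[OF x, of "-1"] by (simp add: J)
    then have "g (scl Z J x) = of_real (U (scl Z J x)) + J * of_real (U x)"
      using x by (simp add: g_def Z.scl_car)
    also have "\<dots> = J * of_real (U x) - (J * J) * of_real (U (scl Z J x))"
      by (simp add: J)
    also have "\<dots> = J * g x"
      using x by (simp add: g_def right_diff_distrib mult.assoc)
    finally show ?thesis .
  qed
  have g_scl: "g (scl Z c x) = c * g x" if x: "x \<in> car Z" for c x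
  proof -
    let ?a = "re c" and ?b = "- re (J * c)"
    have c: "c = of_real ?a + of_real ?b * J"
      using parts[of c] by (simp add: mult.commute)
    have "scl Z c x = ?s ?a x + ?s ?b (scl Z J x)"
      by (subst c) (simp only: Z.scale_left_distrib Z.scale_scale)
    then have "g (scl Z c x) = of_real ?a * g x + of_real ?b * (J * g x)"
      by (simp only: g_add g_real g_J Z.scl_car x)
    also have "\<dots> = (of_real ?a + of_real ?b * J) * g x"
      by (simp add: algebra_simps)
    finally show ?thesis
      using c by simp
  qed
  have re_g: "re (g x) = U x" if "x \<in> car Z" for x
  proof -
    have "g x + of_real (U (scl Z J x)) * J = of_real (U x) * 1"
      using that by (simp add: g_def mult.commute)
    then have "re (g x) + re (of_real (U (scl Z J x)) * J) = re (of_real (U x) * 1)"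
      by (metis re(1))
    then show ?thesis
      by (simp only: re)
  qed
  have g_bound: "norm (g x) \<le> ?N * nrm Z x" if x: "x \<in> car Z" for x
  proof (cases "g x = 0")
    case True
    then show ?thesis
      using N Z.nrm_nonneg[OF x] by simp
  next
    case False
    define c where "c = of_real (norm (g x)) / g x"
    have c: "norm c = 1" "c * g x = of_real (norm (g x)) * 1"
      using False by (simp_all add: c_def norm_divide)
    have "norm (g x) = re (c * g x)"
      unfolding c(2) re by (simp add: re)
    also have "\<dots> = U (scl Z c x)"
      using re_g[OF Z.scl_car[OF x]] by (simp add: g_scl x)
    also have "\<dots> \<le> ?N * nrm Z (scl Z c x)"
      by (rule Up[OF Z.scl_car[OF x]])
    finally show ?thesis
      by (simp add: Z.nrm_scl x c)
  qed
  have g: "g \<in> car (dual Z)"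
    by (rule Z.dualI[OF g_add g_scl g_bound]) (simp_all add: g_def)
  have gf: "dual_map Y T g y = f y" for y
  proof (cases "y \<in> car Y")
    case True
    have UT: "U (T a) = re (f a)" if "a \<in> car Y" for a
      using that by (intro UG) blast
    have "U (scl Z J (T y)) = re (J * f y)"
      using UT[OF Y.scl_car[OF True, of J]] by (simp add: T' True Y.dual_scl[OF f])
    then have "g (T y) = of_real (re (f y)) - J * of_real (re (J * f y))"
      by (simp add: g_def T' True UT)
    then show ?thesis
      using parts[of "f y"] True by (simp add: dual_map_def)
  qed (simp add: dual_map_def Y.dual_outside[OF f])
  show thesis
    by (rule that[OF g Z.dual_nrm_le[OF g_bound N]]) (use gf in auto)
qed


section \<open>Bidual embeddings\<close>

definition bidual_map ::
  "('k::real_normed_field, 'v::ab_group_add) nspace \<Rightarrow> ('k, 'w::ab_group_add) nspace \<Rightarrow> ('v \<Rightarrow> 'w)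
    \<Rightarrow> (('v \<Rightarrow> 'k) \<Rightarrow> 'k) \<Rightarrow> ('w \<Rightarrow> 'k) \<Rightarrow> 'k"
  where "bidual_map Y Z T = dual_map (dual Z) (dual_map Y T)"

text \<open>The norm of \<open>\<phi>\<close> is not decreased, because each functional \<open>f\<close> on \<open>Y\<close> at which \<open>\<phi>\<close> is evaluated
  is the transpose of some \<open>g\<close> on \<open>Z\<close> that is no larger.\<close>

lemma bidual_map_isometric:
  fixes Y :: "('k::real_or_complex, 'v::ab_group_add) nspace"
    and Z :: "('k, 'w::ab_group_add) nspace"
  assumes Y: "seminormed_space Y" and Z: "seminormed_space Z" and T: "isometric_embedding Y Z T"
  shows "isometric_embedding (dual (dual Y)) (dual (dual Z)) (bidual_map Y Z T)"
proof -
  interpret Y': seminormed_space "dual Y" by (rule seminormed_space.seminormed_space_dual[OF Y])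
  interpret Z': seminormed_space "dual Z" by (rule seminormed_space.seminormed_space_dual[OF Z])
  interpret Z'': seminormed_space "dual (dual Z)" by (rule Z'.seminormed_space_dual)
  have "contraction Y Z T" using T by (simp add: isometric_embedding_def)
  then have c: "contraction (dual (dual Y)) (dual (dual Z)) (bidual_map Y Z T)"
    unfolding bidual_map_def
    by (intro dual_map_contraction Y Z Y'.seminormed_space_axioms Z'.seminormed_space_axioms)
  have "nrm (dual (dual Y)) \<phi> \<le> nrm (dual (dual Z)) (bidual_map Y Z T \<phi>)"
    if \<phi>: "\<phi> \<in> car (dual (dual Y))" for \<phi>
  proof (rule Y'.dual_nrm_le)
    note b = contractionD(1)[OF c \<phi>]
    show N: "0 \<le> nrm (dual (dual Z)) (bidual_map Y Z T \<phi>)"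
      by (rule Z''.nrm_nonneg[OF b])
    fix f assume "f \<in> car (dual Y)"
    then obtain g where g: "g \<in> car (dual Z)" "nrm (dual Z) g \<le> nrm (dual Y) f" "dual_map Y T g = f"
      by (rule Hahn_Banach_isometric[OF Y Z T])
    have "norm (\<phi> f) = norm (bidual_map Y Z T \<phi> g)"
      by (simp add: bidual_map_def dual_map_def[of "dual Z"] g)
    also have "\<dots> \<le> nrm (dual (dual Z)) (bidual_map Y Z T \<phi>) * nrm (dual Z) g"
      by (rule Z'.dual_bound[OF b g(1)])
    also have "\<dots> \<le> nrm (dual (dual Z)) (bidual_map Y Z T \<phi>) * nrm (dual Y) f"
      by (rule mult_left_mono[OF g(2) N])
    finally show "norm (\<phi> f) \<le> nrm (dual (dual Z)) (bidual_map Y Z T \<phi>) * nrm (dual Y) f" .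
  qed
  then show ?thesis
    using c contractionD(2)[OF c] by (auto simp: isometric_embedding_def intro: antisym)
qed

lemma bidual_map_canonical:
  assumes "seminormed_space Y" "seminormed_space Z" "contraction Y Z T" "y \<in> car Y"
  shows "bidual_map Y Z T (canonical Y y) = canonical Z (T y)"
proof
  fix f
  show "bidual_map Y Z T (canonical Y y) f = canonical Z (T y) f"
    using contractionD(1)[OF dual_map_contraction[OF assms(1-3)], of f] assms(4)
    by (simp add: bidual_map_def canonical_def dual_map_def)
qed


section \<open>Smooth points and isometric embeddings\<close>

lemma (in seminormed_space) norming_functional:
  assumes "f \<in> car (dual X)" "x \<in> car X" "nrm X x = 1" "f x = 1" "nrm (dual X) f \<le> 1"
  shows "nrm (dual X) f = 1"
  using dual_bound[OF assms(1,2)] assms(3-5) by simp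

text \<open>The norming functional on the larger space restricts to one on the smaller space; it is the
  only one there, as each norming functional on the smaller space extends to one on the larger.\<close>

lemma smooth_point_restrict:
  fixes Y :: "('k::real_or_complex, 'v::ab_group_add) nspace"
    and Z :: "('k, 'w::ab_group_add) nspace"
  assumes Y: "seminormed_space Y" and Z: "seminormed_space Z" and T: "isometric_embedding Y Z T"
    and y: "y \<in> car Y" and smooth: "smooth_point Z (T y)"
  shows "smooth_point Y y"
proof -
  interpret Y: seminormed_space Y by fact
  interpret Z: seminormed_space Z by fact
  have c: "contraction Y Z T" and n: "nrm Y y = 1"
    using T y smooth by (auto simp: isometric_embedding_def smooth_point_def)
  note Ty = contractionD(1)[OF c y]
  note adj = contractionD[OF dual_map_contraction[OF Y Z c]]
  obtain g where g: "g \<in> car (dual Z)" "nrm (dual Z) g = 1" "g (T y) = 1"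
    and unique: "\<And>h. h \<in> car (dual Z) \<Longrightarrow> nrm (dual Z) h = 1 \<Longrightarrow> h (T y) = 1 \<Longrightarrow> h = g"
    using smooth unfolding smooth_point_def by metis
  have val: "dual_map Y T g y = 1"
    using g y by (simp add: dual_map_def)
  have "nrm (dual Y) (dual_map Y T g) = 1"
    using Y.norming_functional[OF adj(1)[OF g(1)] y n val] adj(2)[OF g(1)] g(2) by simp
  moreover have "f = dual_map Y T g" if f: "f \<in> car (dual Y)" "nrm (dual Y) f = 1" "f y = 1" for f
  proof -
    obtain h where h: "h \<in> car (dual Z)" "nrm (dual Z) h \<le> nrm (dual Y) f" "dual_map Y T h = f"
      using f(1) by (rule Hahn_Banach_isometric[OF Y Z T])
    have hy: "h (T y) = 1"
      using h(3) f(3) y by (auto simp: dual_map_def)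
    have "nrm (dual Z) h = 1"
      using Z.norming_functional[OF h(1) Ty _ hy] h(2) f(2) smooth by (simp add: smooth_point_def)
    then show ?thesis using unique h hy by blast
  qed
  ultimately show ?thesis
    unfolding smooth_point_def using y n adj(1)[OF g(1)] val by metis
qed

text \<open>The maps \<open>T\<close> and \<open>L\<close> present \<open>Y\<close> as an \<open>M\<close>-summand of \<open>Z\<close>, with projection \<open>T \<circ> L\<close>. A
  functional \<open>g\<close> that norms the unit vector \<open>T y\<close> vanishes on the complement: for \<open>z\<close> in the unit
  ball and \<open>w = z - T (L z)\<close>, rotated so that \<open>g w \<ge> 0\<close>, the vector \<open>T y + w\<close> still has norm at
  most one, whence \<open>1 + g w \<le> 1\<close>. So \<open>g\<close> factors through \<open>T \<circ> L\<close> and is determined by its values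
  on the range of \<open>T\<close>.\<close>

lemma smooth_point_extend:
  fixes Y :: "('k::real_normed_field, 'v::ab_group_add) nspace"
    and Z :: "('k, 'w::ab_group_add) nspace"
  assumes Y: "seminormed_space Y" and Z: "seminormed_space Z"
    and T: "isometric_embedding Y Z T" and L: "contraction Z Y L"
    and LT: "\<And>y. y \<in> car Y \<Longrightarrow> L (T y) = y"
    and M: "\<And>y z. y \<in> car Y \<Longrightarrow> z \<in> car Z \<Longrightarrow> nrm Z (T y + (z - T (L z))) \<le> max (nrm Y y) (nrm Z z)"
    and smooth: "smooth_point Y y"
  shows "smooth_point Z (T y)"
proof -
  interpret Y: seminormed_space Y by fact
  interpret Z: seminormed_space Z by fact
  have c: "contraction Y Z T" and y: "y \<in> car Y" and ny: "nrm Y y = 1" and nTy: "nrm Z (T y) = 1"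
    using T smooth by (auto simp: isometric_embedding_def smooth_point_def)
  note Ty = contractionD(1)[OF c y]
  note adjT = contractionD[OF dual_map_contraction[OF Y Z c]]
  note adjL = contractionD[OF dual_map_contraction[OF Z Y L]]
  obtain f where f: "f \<in> car (dual Y)" "nrm (dual Y) f = 1" "f y = 1"
    and unique: "\<And>h. h \<in> car (dual Y) \<Longrightarrow> nrm (dual Y) h = 1 \<Longrightarrow> h y = 1 \<Longrightarrow> h = f"
    using smooth unfolding smooth_point_def by metis
  have val: "dual_map Z L f (T y) = 1"
    using f Ty LT[OF y] by (simp add: dual_map_def)
  have "nrm (dual Z) (dual_map Z L f) = 1"
    using Z.norming_functional[OF adjL(1)[OF f(1)] Ty nTy val] adjL(2)[OF f(1)] f(2) by simp
  moreover have "g = dual_map Z L f" if g: "g \<in> car (dual Z)" "nrm (dual Z) g = 1" "g (T y) = 1" for g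
  proof -
    have gT: "dual_map Y T g = f"
    proof (rule unique)
      show "dual_map Y T g y = 1"
        using g y by (simp add: dual_map_def)
      from Y.norming_functional[OF adjT(1)[OF g(1)] y ny this]
      show "nrm (dual Y) (dual_map Y T g) = 1"
        using adjT(2)[OF g(1)] g(2) by simp
    qed (rule adjT(1)[OF g(1)])
    have TL: "T (L z) \<in> car Z" if "z \<in> car Z" for z
      using that contractionD(1)[OF L] contractionD(1)[OF c] by blast
    have unit: "g (z - T (L z)) = 0" if z: "z \<in> car Z" "nrm Z z \<le> 1" for z
    proof (rule ccontr)
      let ?w = "z - T (L z)"
      assume ne: "g ?w \<noteq> 0"
      define a where "a = of_real (norm (g ?w)) / g ?w"
      have a: "norm a = 1" "a * g ?w = of_real (norm (g ?w))"
        using ne by (simp_all add: a_def norm_divide)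
      have az: "scl Z a z \<in> car Z" "nrm Z (scl Z a z) \<le> 1"
        using z a by (simp_all add: Z.scl_car Z.nrm_scl)
      have w: "?w \<in> car Z"
        by (intro Z.diff_car z TL)
      have "T (L (scl Z a z)) = scl Z a (T (L z))"
        using z contractionD(1,4)[OF L] contractionD(4)[OF c] by simp
      then have aw: "scl Z a ?w = scl Z a z - T (L (scl Z a z))"
        by (simp add: Z.scale_right_diff_distrib)
      have "g (T y + scl Z a ?w) = of_real (1 + norm (g ?w))"
        by (simp add: Z.dual_add[OF g(1) Ty Z.scl_car[OF w]] Z.dual_scl[OF g(1) w] a g(3))
      then have "1 + norm (g ?w) = norm (g (T y + scl Z a ?w))"
        by (simp del: of_real_add)
      also have "\<dots> \<le> nrm Z (T y + scl Z a ?w)"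
        using Z.dual_bound[OF g(1) Z.add_car[OF Ty Z.scl_car[OF w]]] by (simp add: g(2))
      also have "\<dots> \<le> 1"
        using M[OF y az(1)] az(2) by (simp add: aw ny)
      finally show False using ne by simp
    qed
    have g_eq: "g z = g (T (L z))" if z: "z \<in> car Z" for z
    proof -
      \<comment> \<open>Adding one to the norm allows scaling into the unit ball also if \<open>nrm Z z = 0\<close>.\<close>
      define r where "r = 1 / (1 + nrm Z z)"
      have r: "0 < r" "r * nrm Z z \<le> 1"
        using Z.nrm_nonneg[OF z] by (simp_all add: r_def field_simps)
      let ?z = "scl Z (of_real r) z"
      have "nrm Z ?z \<le> 1"
        using r by (simp add: Z.nrm_scl z)
      then have "g (?z - T (L ?z)) = 0"
        by (intro unit Z.scl_car z)
      moreover have "T (L ?z) = scl Z (of_real r) (T (L z))"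
        using z contractionD(1,4)[OF L] contractionD(4)[OF c] by simp
      ultimately have "of_real r * g z = of_real r * g (T (L z))"
        using z TL[OF z] by (simp add: Z.dual_diff[OF g(1)] Z.scl_car Z.dual_scl[OF g(1)])
      then show ?thesis
        using r(1) by simp
    qed
    show ?thesis
    proof (rule Z.dual_eqI[OF g(1) adjL(1)[OF f(1)]])
      fix z assume z: "z \<in> car Z"
      show "g z = dual_map Z L f z"
        using g_eq[OF z] z contractionD(1)[OF L z] by (simp add: dual_map_def flip: gT)
    qed
  qed
  ultimately show ?thesis
    unfolding smooth_point_def using Ty nTy adjL(1)[OF f(1)] val by metis
qed


section \<open>Very smooth points of subspaces\<close>

text \<open>The projection \<open>P\<close> of an \<open>M\<close>-ideal has kernel \<open>M\<^sup>\<bottom>\<close>, so \<open>P g\<close> depends on the restriction of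
  \<open>g\<close> to \<open>M\<close> only. Hence \<open>E f = P g\<close>, for any extension \<open>g\<close> of \<open>f\<close>, is a linear lifting of \<open>M\<^sup>*\<close> to
  \<open>X\<^sup>*\<close>, which is contractive since \<open>g\<close> can be taken of the same norm as \<open>f\<close>.\<close>

lemma M_ideal_lifting:
  fixes X :: "('k::real_or_complex, 'v::ab_group_add) nspace"
  assumes X: "seminormed_space X" and N: "seminormed_space (subspace_of X M)" and "M \<subseteq> car X"
    and "M_ideal X M"
  obtains E where "contraction (dual (subspace_of X M)) (dual X) E"
    "\<And>f. f \<in> car (dual (subspace_of X M)) \<Longrightarrow> dual_map (subspace_of X M) id (E f) = f"
    "\<And>g. g \<in> car (dual X) \<Longrightarrow>
      nrm (dual X) (E (dual_map (subspace_of X M) id g)) +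
      nrm (dual X) (g - E (dual_map (subspace_of X M) id g)) = nrm (dual X) g"
proof -
  let ?N = "subspace_of X M" and ?R = "dual_map (subspace_of X M) id"
  interpret X: seminormed_space X by fact
  interpret N: seminormed_space ?N by fact
  interpret X': seminormed_space "dual X" by (rule X.seminormed_space_dual)
  interpret N': seminormed_space "dual ?N" by (rule N.seminormed_space_dual)
  have incl: "isometric_embedding ?N X id"
    using \<open>M \<subseteq> car X\<close> by (auto simp: isometric_embedding_def contraction_def subspace_of_def)
  have R: "contraction (dual X) (dual ?N) ?R"
    using incl by (intro dual_map_contraction N X) (simp add: isometric_embedding_def)
  note R' = contractionD[OF R]
  obtain P where P: "linear_projection (dual X) P"
    and split: "\<And>g. g \<in> car (dual X) \<Longrightarrow> nrm (dual X) (P g) + nrm (dual X) (g - P g) = nrm (dual X) g"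
    and ker: "{g \<in> car (dual X). P g = 0} = annihilator X M"
    using \<open>M_ideal X M\<close> unfolding M_ideal_def by blast
  have P_car: "P g \<in> car (dual X)" and P_idem: "P (P g) = P g"
    and P_scl: "P (scl (dual X) c g) = scl (dual X) c (P g)" if "g \<in> car (dual X)" for g c
    using P that by (auto simp: linear_projection_def)
  have P_add: "P (g + h) = P g + P h" if "g \<in> car (dual X)" "h \<in> car (dual X)" for g h
    using P that by (auto simp: linear_projection_def)
  have P_diff: "P (g - h) = P g - P h" if "g \<in> car (dual X)" "h \<in> car (dual X)" for g h
    using P_add[OF X'.diff_car[OF that] that(2)] by (simp add: algebra_simps)
  have ker_iff: "P g = P h \<longleftrightarrow> ?R g = ?R h" if gh: "g \<in> car (dual X)" "h \<in> car (dual X)" for g h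
  proof -
    have "P g = P h \<longleftrightarrow> g - h \<in> {k \<in> car (dual X). P k = 0}"
      using X'.diff_car[OF gh] P_diff[OF gh] by simp
    also have "\<dots> \<longleftrightarrow> (\<forall>x\<in>M. g x = h x)"
      unfolding ker annihilator_def using X'.diff_car[OF gh] by simp
    also have "\<dots> \<longleftrightarrow> ?R g = ?R h"
      by (auto simp: dual_map_def subspace_of_def fun_eq_iff)
    finally show ?thesis .
  qed
  have ext: "\<exists>g. g \<in> car (dual X) \<and> nrm (dual X) g \<le> nrm (dual ?N) f \<and> ?R g = f"
    if "f \<in> car (dual ?N)" for f
    using Hahn_Banach_isometric[OF N X incl that] by blast
  define E where "E f = P (SOME g. g \<in> car (dual X) \<and> ?R g = f)" for f
  have E_R: "E (?R g) = P g" if g: "g \<in> car (dual X)" for g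
  proof -
    let ?h = "SOME h. h \<in> car (dual X) \<and> ?R h = ?R g"
    have "?h \<in> car (dual X) \<and> ?R ?h = ?R g"
      by (rule someI[of _ g]) (use g in simp)
    then show ?thesis
      using ker_iff g by (simp add: E_def)
  qed
  have P_le: "nrm (dual X) (P g) \<le> nrm (dual X) g" if "g \<in> car (dual X)" for g
    using split[OF that] X'.nrm_nonneg[OF X'.diff_car[OF that P_car[OF that]]] by simp
  show thesis
  proof (rule that)
    show "contraction (dual ?N) (dual X) E"
      unfolding contraction_def
    proof (intro conjI ballI allI)
      fix f assume "f \<in> car (dual ?N)"
      then obtain g where g: "g \<in> car (dual X)" "nrm (dual X) g \<le> nrm (dual ?N) f" "?R g = f"
        using ext by blast
      have E: "E f = P g" using E_R g by blast
      show "E f \<in> car (dual X)" "nrm (dual X) (E f) \<le> nrm (dual ?N) f"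
        using P_car[OF g(1)] P_le[OF g(1)] g(2) by (simp_all add: E)
      show "E (scl (dual ?N) c f) = scl (dual X) c (E f)" for c
        using E_R[OF X'.scl_car[OF g(1), of c]] by (simp add: R' g E P_scl)
      fix f' assume "f' \<in> car (dual ?N)"
      then obtain g' where g': "g' \<in> car (dual X)" "?R g' = f'"
        using ext by blast
      have E': "E f' = P g'" using E_R g' by blast
      show "E (f + f') = E f + E f'"
        using E_R[OF X'.add_car[OF g(1) g'(1)]] by (simp add: R' g g' E E' P_add)
    qed
    show "?R (E f) = f" if f: "f \<in> car (dual ?N)" for f
    proof -
      obtain g where g: "g \<in> car (dual X)" "?R g = f"
        using ext[OF f] by blast
      have "?R (P g) = ?R g"
        using ker_iff[OF P_car[OF g(1)] g(1)] P_idem[OF g(1)] by simp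
      then show ?thesis using E_R[OF g(1)] g(2) by simp
    qed
    show "nrm (dual X) (E (?R g)) + nrm (dual X) (g - E (?R g)) = nrm (dual X) g"
      if "g \<in> car (dual X)" for g
      using split[OF that] by (simp add: E_R[OF that])
  qed
qed

text \<open>Dualising the \<open>\<ell>\<^sub>1\<close>-decomposition of \<open>X\<^sup>*\<close> makes \<open>M\<^sup>*\<^sup>*\<close> an \<open>M\<close>-summand of \<open>X\<^sup>*\<^sup>*\<close>, the transpose of
  the lifting of \<open>M\<^sup>*\<close> being the contraction onto it. For the norm estimate, the sum of \<open>\<psi>\<close> from the
  summand and the complementary part of \<open>\<Phi>\<close> takes at \<open>g\<close> the value of \<open>\<psi>\<close> at the restriction
  of \<open>P g\<close> plus that of \<open>\<Phi>\<close> at \<open>g - P g\<close>, where \<open>P g\<close> is the lifting of the restriction of \<open>g\<close>, and the norms of \<open>P g\<close> and \<open>g - P g\<close> add up to that of \<open>g\<close>.\<close>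

lemma M_ideal_smooth_point_bidual:
  fixes X :: "('k::real_or_complex, 'v::ab_group_add) nspace"
  assumes X: "seminormed_space X" and N: "seminormed_space (subspace_of X M)" and "M \<subseteq> car X"
    and "M_ideal X M"
    and smooth: "smooth_point (dual (dual (subspace_of X M))) \<phi>"
  shows "smooth_point (dual (dual X)) (bidual_map (subspace_of X M) X id \<phi>)"
proof -
  let ?N = "subspace_of X M" and ?R = "dual_map (subspace_of X M) id"
  let ?B = "bidual_map ?N X id"
  interpret X': seminormed_space "dual X" by (rule seminormed_space.seminormed_space_dual[OF X])
  interpret N': seminormed_space "dual ?N" by (rule seminormed_space.seminormed_space_dual[OF N])
  interpret X'': seminormed_space "dual (dual X)" by (rule X'.seminormed_space_dual)
  interpret N'': seminormed_space "dual (dual ?N)" by (rule N'.seminormed_space_dual)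
  have incl: "isometric_embedding ?N X id"
    using \<open>M \<subseteq> car X\<close> by (auto simp: isometric_embedding_def contraction_def subspace_of_def)
  then have R: "contraction (dual X) (dual ?N) ?R"
    by (intro dual_map_contraction N X) (simp add: isometric_embedding_def)
  note R' = contractionD[OF R]
  obtain E where E: "contraction (dual ?N) (dual X) E"
    and RE: "\<And>f. f \<in> car (dual ?N) \<Longrightarrow> ?R (E f) = f"
    and split: "\<And>g. g \<in> car (dual X) \<Longrightarrow>
      nrm (dual X) (E (?R g)) + nrm (dual X) (g - E (?R g)) = nrm (dual X) g"
    by (rule M_ideal_lifting[OF X N assms(3,4)]) blast
  note E' = contractionD[OF E]
  let ?L = "dual_map (dual ?N) E"
  show ?thesis
  proof (rule smooth_point_extend[where T = ?B and L = ?L and Y = "dual (dual ?N)"])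
    show B: "isometric_embedding (dual (dual ?N)) (dual (dual X)) ?B"
      by (rule bidual_map_isometric[OF N X incl])
    show L: "contraction (dual (dual X)) (dual (dual ?N)) ?L"
      by (rule dual_map_contraction[OF N'.seminormed_space_axioms X'.seminormed_space_axioms E])
    show "?L (?B \<psi>) = \<psi>" if "\<psi> \<in> car (dual (dual ?N))" for \<psi>
    proof
      fix f
      show "?L (?B \<psi>) f = \<psi> f"
        using N'.dual_outside[OF that] E'(1)[of f] RE[of f]
        by (simp add: bidual_map_def dual_map_def[of "dual ?N"] dual_map_def[of "dual X"])
    qed
    fix \<psi> \<Phi> assume \<psi>: "\<psi> \<in> car (dual (dual ?N))" and \<Phi>: "\<Phi> \<in> car (dual (dual X))"
    let ?m = "max (nrm (dual (dual ?N)) \<psi>) (nrm (dual (dual X)) \<Phi>)"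
    show "nrm (dual (dual X)) (?B \<psi> + (\<Phi> - ?B (?L \<Phi>))) \<le> ?m"
    proof (rule X'.dual_nrm_le)
      show "0 \<le> ?m"
        using N''.nrm_nonneg[OF \<psi>] by simp
      fix g assume g: "g \<in> car (dual X)"
      let ?Pg = "E (?R g)"
      have Pg: "?Pg \<in> car (dual X)" and d: "g - ?Pg \<in> car (dual X)"
        using R'(1)[OF g] E'(1) X'.diff_car[OF g] by blast+
      \<comment> \<open>Lifting the restriction of \<open>g\<close> leaves it unchanged on \<open>M\<close>, so \<open>\<psi>\<close> sees no difference.\<close>
      have "\<psi> (?R g) = \<psi> (?R ?Pg)"
        by (simp add: RE R'(1)[OF g])
      then have val: "(?B \<psi> + (\<Phi> - ?B (?L \<Phi>))) g = \<psi> (?R ?Pg) + \<Phi> (g - ?Pg)"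
        using g R'(1)[OF g] X'.dual_diff[OF \<Phi> g Pg]
        by (simp add: bidual_map_def dual_map_def[of "dual ?N"] dual_map_def[of "dual X"])
      have "norm ((?B \<psi> + (\<Phi> - ?B (?L \<Phi>))) g) \<le> norm (\<psi> (?R ?Pg)) + norm (\<Phi> (g - ?Pg))"
        unfolding val by (rule norm_triangle_ineq)
      also have "\<dots> \<le> nrm (dual (dual ?N)) \<psi> * nrm (dual ?N) (?R ?Pg)
          + nrm (dual (dual X)) \<Phi> * nrm (dual X) (g - ?Pg)"
        by (rule add_mono[OF N'.dual_bound[OF \<psi> R'(1)[OF Pg]] X'.dual_bound[OF \<Phi> d]])
      also have "\<dots> \<le> ?m * nrm (dual X) ?Pg + ?m * nrm (dual X) (g - ?Pg)"
      proof (rule add_mono)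
        show "nrm (dual (dual ?N)) \<psi> * nrm (dual ?N) (?R ?Pg) \<le> ?m * nrm (dual X) ?Pg"
          by (rule mult_mono[OF max.cobounded1 R'(2)[OF Pg] \<open>0 \<le> ?m\<close> N'.nrm_nonneg[OF R'(1)[OF Pg]]])
        show "nrm (dual (dual X)) \<Phi> * nrm (dual X) (g - ?Pg) \<le> ?m * nrm (dual X) (g - ?Pg)"
          by (rule mult_right_mono[OF max.cobounded2 X'.nrm_nonneg[OF d]])
      qed
      also have "\<dots> = ?m * nrm (dual X) g"
        unfolding split[OF g, symmetric] by (rule distrib_left[symmetric])
      finally show "norm ((?B \<psi> + (\<Phi> - ?B (?L \<Phi>))) g) \<le> ?m * nrm (dual X) g" .
    qed
  qed (fact N''.seminormed_space_axioms X''.seminormed_space_axioms smooth)+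
qed

theorem proposition2:
  fixes sc :: "'k::real_or_complex \<Rightarrow> 'a::banach \<Rightarrow> 'a" and M :: "'a set"
  assumes "vector_space sc"
    and "\<And>r x. sc (of_real r) x = r *\<^sub>R x"
    and "\<And>c x. norm (sc c x) = norm c * norm x"
    and "module.subspace sc M" and "closed M"
  shows "(\<forall>m\<in>M. very_smooth_point (type_space sc) m \<longrightarrow>
             very_smooth_point (subspace_of (type_space sc) M) m) \<and>
         (M_ideal (type_space sc) M \<longrightarrow>
           (\<forall>m. very_smooth_point (subspace_of (type_space sc) M) m \<longrightarrow>
             very_smooth_point (type_space sc) m))"
proof -
  let ?X = "type_space sc"
  let ?N = "subspace_of ?X M"
  let ?B = "bidual_map ?N ?X id"
  interpret X: seminormed_space ?X
    by (rule seminormed_space_type_space[OF assms(1,3)])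
  have MX: "M \<subseteq> car ?X" and sp: "X.subspace M"
    using assms(4) by (simp_all add: type_space_def)
  interpret N: seminormed_space ?N
    by (rule X.seminormed_space_subspace_of[OF sp MX])
  interpret X': seminormed_space "dual ?X" by (rule X.seminormed_space_dual)
  interpret N': seminormed_space "dual ?N" by (rule N.seminormed_space_dual)
  have incl: "isometric_embedding ?N ?X id"
    using MX by (auto simp: isometric_embedding_def contraction_def subspace_of_def)
  have B: "isometric_embedding (dual (dual ?N)) (dual (dual ?X)) ?B"
    by (rule bidual_map_isometric[OF N.seminormed_space_axioms X.seminormed_space_axioms incl])
  have can: "?B (canonical ?N m) = canonical ?X m" if "m \<in> M" for m
    using bidual_map_canonical[OF N.seminormed_space_axioms X.seminormed_space_axioms, of id m] incl that
    by (simp add: isometric_embedding_def subspace_of_def)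
  have "very_smooth_point ?N m" if m: "m \<in> M" and vs: "very_smooth_point ?X m" for m
    unfolding very_smooth_point_def
  proof (intro conjI)
    show mN: "m \<in> car ?N" "nrm ?N m = 1"
      using m vs by (simp_all add: very_smooth_point_def subspace_of_def)
    show "smooth_point (dual (dual ?N)) (canonical ?N m)"
      using vs can[OF m]
      by (intro smooth_point_restrict[OF N'.seminormed_space_dual X'.seminormed_space_dual B]
          N.canonical_in_bidual mN) (simp add: very_smooth_point_def)
  qed
  moreover have "very_smooth_point ?X m"
    if "M_ideal ?X M" and vs: "very_smooth_point ?N m" for m
  proof -
    have m: "m \<in> M" "nrm ?X m = 1" and sm: "smooth_point (dual (dual ?N)) (canonical ?N m)"
      using vs by (simp_all add: very_smooth_point_def subspace_of_def)
    have "smooth_point (dual (dual ?X)) (canonical ?X m)"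
      using M_ideal_smooth_point_bidual[OF X.seminormed_space_axioms N.seminormed_space_axioms MX that(1) sm]
      by (simp add: can[OF m(1)])
    then show ?thesis
      using m MX by (auto simp: very_smooth_point_def)
  qed
  ultimately show ?thesis by blast
qed

end
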